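(* For every $m\ge1$, $\mathrm{Extr}\,\mathbf{U}_m\cap\mathbf{U}_m^{(0,\frac12)}=\{\Theta_{m\times m}\}$, where $\Theta_{m\times m}$ is the $m\times m$ zero matrix.
   Context: $I_m=\{1,\dots,m\}$. $\mathbf{U}_m$ is the set of real $m\times m$ matrices $A_m=(a_{ij})$ with $a_{ij}=a_{ji}\ge 0$ for all $i,j$ and $\sum_{i,j\in\alpha}a_{ij}\le|\alpha|$ for every $\alpha\subset I_m$ ($|\alpha|$ the cardinality). $\mathbf{U}_m^{(0,\frac12)}=\{A_m\in\mathbf{U}_m: a_{ii}=0,\ a_{ij}\in\{0,\frac12\}\ \forall i,j\}$. $\mathrm{Extr}$ denotes the set of extreme points. *)

theory Defs
  imports "HOL-Analysis.Analysis"
begin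

text \<open>The index set $I_m$ is represented by a finite type \<open>'n\<close> with \<open>CARD('n)\<close> $= m \ge 1$.\<close>

definition U_set :: "(real ^ 'n ^ 'n) set" where
  "U_set = {A. (\<forall>i j. A $ i $ j = A $ j $ i \<and> A $ i $ j \<ge> 0) \<and>
               (\<forall>\<alpha> :: 'n set. (\<Sum>i\<in>\<alpha>. \<Sum>j\<in>\<alpha>. A $ i $ j) \<le> real (card \<alpha>))}"

definition U_half_set :: "(real ^ 'n ^ 'n) set" where
  "U_half_set = {A \<in> U_set. (\<forall>i. A $ i $ i = 0) \<and> (\<forall>i j. A $ i $ j \<in> {0, 1/2})}"

definition Extr :: "'a::real_vector set \<Rightarrow> 'a set" where
  "Extr S = {x. x extreme_point_of S}"

end

theory Submission
  imports Defs
begin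

text \<open>A matrix with entries in {0, 1/2} and zero diagonal is a graph, and the sum over \<open>\<alpha>\<close> is its number
  of edges inside \<open>\<alpha>\<close>. This count is supermodular, so the tight sets are closed under intersection,
  and a minimal nonempty tight set \<open>\<alpha>\<close> is contained in or disjoint from every other tight set. It
  contains two distinct edges, whose weights can be moved in opposite directions without disturbing
  any tight constraint. If there is no nonempty tight set, any single edge can be moved. Since
  twice the sums are integers, the constraints that are not tight have slack at least 1/2.\<close>

definition block_sum :: "real ^ 'n ^ 'n \<Rightarrow> 'n set \<Rightarrow> real" where
  "block_sum A \<alpha> = (\<Sum>i\<in>\<alpha>. \<Sum>j\<in>\<alpha>. A $ i $ j)"

text \<open>The weight 1/4 is half of an entry 1/2, so an edge of \<open>A\<close> can absorb it.
  For distinct \<open>i\<close> and \<open>j\<close> both ordered pairs count, so a block sum moves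
  by at most 1/2, which is the slack of a constraint that is not tight.\<close>

definition edge_matrix :: "'n \<Rightarrow> 'n \<Rightarrow> real ^ 'n ^ 'n" where
  "edge_matrix i j = (\<chi> a b. if a = i \<and> b = j \<or> a = j \<and> b = i then 1/4 else 0)"

lemma edge_matrix_sym: "edge_matrix i j $ a $ b = edge_matrix i j $ b $ a"
  by (auto simp: edge_matrix_def)

lemma edge_matrix_nonneg: "edge_matrix i j $ a $ b \<ge> 0"
  by (simp add: edge_matrix_def)

lemma edge_matrix_le:
  assumes "A \<in> U_set" "A $ i $ j = 1/2"
  shows "edge_matrix i j $ a $ b \<le> A $ a $ b"
proof -
  have "A $ j $ i = 1/2" "A $ a $ b \<ge> 0" using assms by (auto simp: U_set_def)
  then show ?thesis using assms(2) by (auto simp: edge_matrix_def)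
qed

lemma block_sum_Times: "block_sum A \<alpha> = (\<Sum>p\<in>\<alpha> \<times> \<alpha>. A $ fst p $ snd p)"
  by (simp add: block_sum_def sum.cartesian_product case_prod_unfold)

lemma block_sum_add: "block_sum (A + B) \<alpha> = block_sum A \<alpha> + block_sum B \<alpha>"
  by (simp add: block_sum_def sum.distrib)

lemma block_sum_diff: "block_sum (A - B) \<alpha> = block_sum A \<alpha> - block_sum B \<alpha>"
  by (simp add: block_sum_def sum_subtractf)

lemma block_sum_edge_matrix:
  assumes "i \<noteq> j"
  shows "block_sum (edge_matrix i j) \<beta> = (if i \<in> \<beta> \<and> j \<in> \<beta> then 1/2 else 0)"
proof -
  have "block_sum (edge_matrix i j) \<beta> = (\<Sum>p\<in>\<beta> \<times> \<beta>. if p \<in> {(i,j),(j,i)} then 1/4 else 0)"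
    unfolding block_sum_Times edge_matrix_def by (intro sum.cong) auto
  also have "\<dots> = (\<Sum>p\<in>(\<beta> \<times> \<beta>) \<inter> {(i,j),(j,i)}. 1/4)"
    by (subst sum.inter_restrict) auto
  also have "(\<beta> \<times> \<beta>) \<inter> {(i,j),(j,i)} = (if i \<in> \<beta> \<and> j \<in> \<beta> then {(i,j),(j,i)} else {})"
    by auto
  finally show ?thesis using assms by auto
qed

text \<open>The squares of \<alpha> and \<beta> meet exactly in the square of the intersection,
  while their union may miss pairs running between \<alpha> - \<beta> and \<beta> - \<alpha>. Those
  pairs carry nonnegative entries.\<close>

lemma block_sum_supermodular:
  assumes "\<And>i j. A $ i $ j \<ge> 0"
  shows "block_sum A \<alpha> + block_sum A \<beta> \<le> block_sum A (\<alpha> \<union> \<beta>) + block_sum A (\<alpha> \<inter> \<beta>)"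
proof -
  let ?g = "\<lambda>p. A $ fst p $ snd p"
  have "block_sum A \<alpha> + block_sum A \<beta>
      = sum ?g (\<alpha> \<times> \<alpha> \<union> \<beta> \<times> \<beta>) + sum ?g (\<alpha> \<times> \<alpha> \<inter> \<beta> \<times> \<beta>)"
    unfolding block_sum_Times by (rule sum.union_inter[symmetric]) auto
  also have "sum ?g (\<alpha> \<times> \<alpha> \<union> \<beta> \<times> \<beta>) \<le> block_sum A (\<alpha> \<union> \<beta>)"
    unfolding block_sum_Times using assms by (intro sum_mono2) auto
  also have "\<alpha> \<times> \<alpha> \<inter> \<beta> \<times> \<beta> = (\<alpha> \<inter> \<beta>) \<times> (\<alpha> \<inter> \<beta>)" by auto
  finally show ?thesis by (simp add: block_sum_Times)
qed

lemma mem_U_set_iff: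
  "A \<in> U_set \<longleftrightarrow> (\<forall>i j. A $ i $ j = A $ j $ i) \<and> (\<forall>i j. A $ i $ j \<ge> 0) \<and>
     (\<forall>\<alpha>. block_sum A \<alpha> \<le> real (card \<alpha>))"
  by (auto simp: U_set_def block_sum_def)

text \<open>Cardinality is modular and the block sum supermodular, so the upper bounds for union and
  intersection must both be attained.\<close>

lemma tight_Int:
  assumes "A \<in> U_set" "block_sum A \<alpha> = card \<alpha>" "block_sum A \<beta> = card \<beta>"
  shows "block_sum A (\<alpha> \<inter> \<beta>) = card (\<alpha> \<inter> \<beta>)"
proof -
  have "block_sum A \<alpha> + block_sum A \<beta> \<le> block_sum A (\<alpha> \<union> \<beta>) + block_sum A (\<alpha> \<inter> \<beta>)"
    using assms(1) by (intro block_sum_supermodular) (auto simp: mem_U_set_iff)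
  moreover have "real (card \<alpha>) + real (card \<beta>) = real (card (\<alpha> \<union> \<beta>)) + real (card (\<alpha> \<inter> \<beta>))"
    using card_Un_Int[of \<alpha> \<beta>] by (simp flip: of_nat_add)
  moreover have "block_sum A (\<alpha> \<union> \<beta>) \<le> card (\<alpha> \<union> \<beta>)" "block_sum A (\<alpha> \<inter> \<beta>) \<le> card (\<alpha> \<inter> \<beta>)"
    using assms(1) by (auto simp: mem_U_set_iff)
  ultimately show ?thesis using assms(2,3) by linarith
qed

lemma half_block_sum_slack:
  assumes "A \<in> U_half_set" "block_sum A \<alpha> \<noteq> card \<alpha>"
  shows "block_sum A \<alpha> + 1/2 \<le> card \<alpha>"
proof -
  have "2 * A $ i $ j \<in> \<int>" for i j
  proof -
    have "A $ i $ j \<in> {0, 1/2}"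
      using assms(1) by (simp add: U_half_set_def)
    then have "2 * A $ i $ j \<in> {0, 1}" by auto
    moreover have "{0, 1 :: real} \<subseteq> \<int>" by simp
    ultimately show ?thesis by (rule rev_subsetD)
  qed
  then have "2 * block_sum A \<alpha> \<in> \<int>"
    unfolding block_sum_def sum_distrib_left by (intro Ints_sum)
  then obtain k where k: "2 * block_sum A \<alpha> = of_int k" by (elim Ints_cases)
  have "block_sum A \<alpha> < card \<alpha>"
    using assms by (auto simp: U_half_set_def mem_U_set_iff order_less_le)
  then have "of_int k < (of_int (2 * int (card \<alpha>)) :: real)" using k by simp
  then have "k + 1 \<le> 2 * int (card \<alpha>)" unfolding of_int_less_iff by linarith
  then have "of_int (k + 1) \<le> (of_int (2 * int (card \<alpha>)) :: real)" unfolding of_int_le_iff .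
  then show ?thesis using k by simp
qed

text \<open>\<open>A\<close> is the midpoint of \<open>A + D\<close> and \<open>A - D\<close>. Both
  stay in \<open>U_set\<close>: \<open>bound\<close> keeps the entries nonnegative,
  \<open>tight\<close> preserves the tight constraints, and \<open>small\<close> fits into the slack
  of all the others.\<close>

lemma not_extreme_perturbation:
  fixes A D :: "real ^ 'n ^ 'n"
  assumes half: "A \<in> U_half_set" and "D \<noteq> 0"
    and sym: "\<And>i j. D $ i $ j = D $ j $ i"
    and bound: "\<And>i j. \<bar>D $ i $ j\<bar> \<le> A $ i $ j"
    and small: "\<And>\<beta>. \<bar>block_sum D \<beta>\<bar> \<le> 1/2"
    and tight: "\<And>\<beta>. block_sum A \<beta> = card \<beta> \<Longrightarrow> block_sum D \<beta> = 0"
  shows "\<not> A extreme_point_of U_set"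
proof
  assume ext: "A extreme_point_of U_set"
  have U: "A \<in> U_set" using half by (simp add: U_half_set_def)
  \<comment> \<open>The absolute value serves both signs of \<open>D\<close> at once.\<close>
  have le: "block_sum A \<beta> + \<bar>block_sum D \<beta>\<bar> \<le> card \<beta>" for \<beta>
    using half_block_sum_slack[OF half, of \<beta>] tight[of \<beta>] small[of \<beta>] by fastforce
  have nonneg: "A $ i $ j + D $ i $ j \<ge> 0" "A $ i $ j - D $ i $ j \<ge> 0" for i j
    using bound[of i j] by linarith+
  have sums: "block_sum A \<beta> + block_sum D \<beta> \<le> card \<beta>" "block_sum A \<beta> - block_sum D \<beta> \<le> card \<beta>"
    for \<beta> using le[of \<beta>] by linarith+
  have symA: "A $ i $ j = A $ j $ i" for i j using U by (simp add: mem_U_set_iff)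
  have "A + D \<in> U_set"
    unfolding mem_U_set_iff block_sum_add using nonneg sums symA sym by simp
  moreover have "A - D \<in> U_set"
    unfolding mem_U_set_iff block_sum_diff using nonneg sums symA sym by simp
  moreover have "A + D \<noteq> A - D"
  proof
    assume "A + D = A - D"
    then have "2 *\<^sub>R D = 0" by (simp add: scaleR_2 algebra_simps)
    with \<open>D \<noteq> 0\<close> show False by simp
  qed
  moreover have "midpoint (A + D) (A - D) = A"
    by (simp add: midpoint_def scaleR_2 flip: scaleR_add_left)
  ultimately show False
    using ext midpoint_in_open_segment[of "A + D" "A - D"]
    by (auto simp: extreme_point_of_def)
qed

text \<open>One edge, counted in both orientations, contributes at most 1, but its two endpoints
  already force \<alpha> to have at least 2 elements. The second edge may share a vertex with the
  first.\<close>

lemma tight_two_edges: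
  assumes half: "A \<in> U_half_set" and tight: "block_sum A \<alpha> = card \<alpha>" and "\<alpha> \<noteq> {}"
  obtains i j k l where "i \<in> \<alpha>" "j \<in> \<alpha>" "k \<in> \<alpha>" "l \<in> \<alpha>"
    "A $ i $ j = 1/2" "A $ k $ l = 1/2" "(k, l) \<noteq> (i, j)" "(k, l) \<noteq> (j, i)"
proof -
  let ?g = "\<lambda>p. A $ fst p $ snd p"
  have vals: "A $ i $ j = 0 \<or> A $ i $ j = 1/2" for i j
    using half by (auto simp: U_half_set_def)
  have "block_sum A \<alpha> \<noteq> 0" using tight \<open>\<alpha> \<noteq> {}\<close> by (simp add: card_eq_0_iff)
  then obtain i j where ij: "i \<in> \<alpha>" "j \<in> \<alpha>" "A $ i $ j \<noteq> 0"
    unfolding block_sum_def by (meson sum.neutral)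
  have "i \<noteq> j" using ij half by (auto simp: U_half_set_def)
  have "\<exists>k\<in>\<alpha>. \<exists>l\<in>\<alpha>. A $ k $ l \<noteq> 0 \<and> (k, l) \<noteq> (i, j) \<and> (k, l) \<noteq> (j, i)"
  proof (rule ccontr)
    assume none: "\<not> ?thesis"
    have "block_sum A \<alpha> = sum ?g {(i, j), (j, i)}"
      unfolding block_sum_Times 
    proof (intro sum.mono_neutral_right ballI)
      fix p assume "p \<in> \<alpha> \<times> \<alpha> - {(i, j), (j, i)}"
      then show "?g p = 0" using none by (cases p, simp) blast
    qed (use ij in auto)
    also have "\<dots> \<le> 1" using vals[of i j] vals[of j i] \<open>i \<noteq> j\<close> by auto
    finally have "card \<alpha> \<le> 1" using tight by simp
    moreover have "card {i, j} \<le> card \<alpha>" using ij by (intro card_mono) auto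
    ultimately show False using \<open>i \<noteq> j\<close> by simp
  qed
  then show thesis using that ij vals by metis
qed

lemma U_half_set_nonzero_not_extreme:
  fixes A :: "real ^ 'n ^ 'n"
  assumes half: "A \<in> U_half_set" and "A \<noteq> 0"
  shows "\<not> A extreme_point_of U_set"
proof -
  have U: "A \<in> U_set" and diag: "A $ i $ i = 0"
    and vals: "A $ i $ j = 0 \<or> A $ i $ j = 1/2" for i j
    using half by (auto simp: U_half_set_def)
  show ?thesis
  proof (cases "\<exists>\<alpha>. \<alpha> \<noteq> {} \<and> block_sum A \<alpha> = card \<alpha>")
    \<comment> \<open>The empty set is always tight, but it contains no edge and so imposes nothing
      on the perturbation.\<close>
    case False
    obtain i j where "A $ i $ j \<noteq> 0"
      using \<open>A \<noteq> 0\<close> by (auto simp: vec_eq_iff)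
    then have ij: "A $ i $ j = 1/2" "i \<noteq> j"
      using vals diag by metis+
    show ?thesis
    proof (rule not_extreme_perturbation[OF half])
      show "edge_matrix i j \<noteq> 0"
        by (auto simp: edge_matrix_def vec_eq_iff)
      show "\<bar>edge_matrix i j $ a $ b\<bar> \<le> A $ a $ b" for a b
        using edge_matrix_le[OF U ij(1)] edge_matrix_nonneg[of i j] by simp
      show "block_sum (edge_matrix i j) \<beta> = 0" if "block_sum A \<beta> = card \<beta>" for \<beta>
        using that False ij by (auto simp: block_sum_edge_matrix)
      show "edge_matrix i j $ a $ b = edge_matrix i j $ b $ a" for a b
        by (rule edge_matrix_sym)
    qed (simp add: block_sum_edge_matrix ij)
  next
    case True
    then obtain \<gamma> where "\<gamma> \<noteq> {} \<and> block_sum A \<gamma> = card \<gamma>" ..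
    from ex_has_least_nat[where P = "\<lambda>\<alpha>. \<alpha> \<noteq> {} \<and> block_sum A \<alpha> = card \<alpha>", OF this, of card]
    obtain \<alpha> where \<alpha>: "\<alpha> \<noteq> {}" "block_sum A \<alpha> = card \<alpha>"
      and min: "\<And>\<beta>. \<lbrakk>\<beta> \<noteq> {}; block_sum A \<beta> = card \<beta>\<rbrakk> \<Longrightarrow> card \<alpha> \<le> card \<beta>"
      by auto
    \<comment> \<open>A nonempty intersection is itself tight, so minimality of
      \<open>card \<alpha>\<close> makes it all of \<alpha>.\<close>
    have dich: "\<alpha> \<subseteq> \<beta> \<or> \<alpha> \<inter> \<beta> = {}" if "block_sum A \<beta> = card \<beta>" for \<beta>
    proof (cases "\<alpha> \<inter> \<beta> = {}")
      case False
      then have "card \<alpha> \<le> card (\<alpha> \<inter> \<beta>)" by (intro min tight_Int[OF U \<alpha>(2) that])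
      then have "\<alpha> \<inter> \<beta> = \<alpha>" by (intro card_seteq) auto
      then show ?thesis by blast
    qed simp
    obtain i j k l where mem: "i \<in> \<alpha>" "j \<in> \<alpha>" "k \<in> \<alpha>" "l \<in> \<alpha>"
      and e: "A $ i $ j = 1/2" "A $ k $ l = 1/2"
      and ne: "(k, l) \<noteq> (i, j)" "(k, l) \<noteq> (j, i)"
      using tight_two_edges[OF half \<alpha>(2,1)] .
    have "i \<noteq> j" "k \<noteq> l" using e diag by auto
    let ?D = "edge_matrix i j - edge_matrix k l"
    have sumD: "block_sum ?D \<beta> = (if i \<in> \<beta> \<and> j \<in> \<beta> then 1/2 else 0) - (if k \<in> \<beta> \<and> l \<in> \<beta> then 1/2 else 0)"
      for \<beta> using \<open>i \<noteq> j\<close> \<open>k \<noteq> l\<close> by (simp only: block_sum_diff block_sum_edge_matrix not_False_eq_True)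
    show ?thesis
    proof (rule not_extreme_perturbation[OF half])
      \<comment> \<open>The edges differ even as unordered pairs, so the second one does not cancel
        this entry.\<close>
      have "?D $ i $ j = 1/4" using ne by (auto simp: edge_matrix_def)
      then show "?D \<noteq> 0" by auto
      show "?D $ a $ b = ?D $ b $ a" for a b
        using edge_matrix_sym[of i j a b] edge_matrix_sym[of k l a b] by simp
      \<comment> \<open>The difference of two nonnegative numbers is bounded in absolute value by
        the larger, and each is at most the entry of \<open>A\<close>.\<close>
      show "\<bar>?D $ a $ b\<bar> \<le> A $ a $ b" for a b
        using edge_matrix_le[OF U e(1), of a b] edge_matrix_le[OF U e(2), of a b]
          edge_matrix_nonneg[of i j a b] edge_matrix_nonneg[of k l a b] by simp
      show "\<bar>block_sum ?D \<beta>\<bar> \<le> 1/2" for \<beta> unfolding sumD by auto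
      \<comment> \<open>By \<open>dich\<close>, a tight \<beta> contains both edges or neither, and
        the two changes cancel.\<close>
      show "block_sum ?D \<beta> = 0" if "block_sum A \<beta> = card \<beta>" for \<beta>
        using dich[OF that] mem unfolding sumD by auto
    qed
  qed
qed

text \<open>Entries in \<open>U_set\<close> are nonnegative, so a combination with strictly positive
  weights vanishes only if both endpoints do.\<close>

lemma zero_extreme_point_of_U_set: "0 extreme_point_of (U_set :: (real ^ 'n ^ 'n) set)"
  unfolding extreme_point_of_def
proof (intro conjI ballI notI)
  show "0 \<in> (U_set :: (real ^ 'n ^ 'n) set)" by (simp add: U_set_def)
next
  fix a b :: "real ^ 'n ^ 'n"
  assume ab: "a \<in> U_set" "b \<in> U_set" and "0 \<in> open_segment a b"
  then obtain u where u: "0 < u" "u < 1" "0 = (1 - u) *\<^sub>R a + u *\<^sub>R b" and "a \<noteq> b"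
    by (auto simp: in_segment)
  have "a $ i $ j = 0 \<and> b $ i $ j = 0" for i j
  proof -
    have "(1 - u) * a $ i $ j + u * b $ i $ j = 0"
      using arg_cong[OF u(3), of "\<lambda>x. x $ i $ j"] by simp
    moreover have "(1 - u) * a $ i $ j \<ge> 0" "u * b $ i $ j \<ge> 0"
      using ab u by (auto simp: mem_U_set_iff)
    ultimately have "(1 - u) * a $ i $ j = 0" "u * b $ i $ j = 0" by linarith+
    then show ?thesis using u by simp
  qed
  then have "a = b" by (simp add: vec_eq_iff)
  with \<open>a \<noteq> b\<close> show False ..
qed

theorem theorem3p10:
  shows "Extr (U_set :: (real ^ 'n ^ 'n) set) \<inter> U_half_set = {0}"
proof -
  have "(0 :: real ^ 'n ^ 'n) \<in> U_half_set" by (simp add: U_half_set_def U_set_def)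
  then show ?thesis
    using U_half_set_nonzero_not_extreme zero_extreme_point_of_U_set
    by (auto simp: Extr_def)
qed

end
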